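(* Let $p$ be a density with support $S_p=[a,b]:=\{a,a+1,\ldots,b\}\subset\mathbb{Z}$, where $a<b$ and $a,b\in\mathbb{Z}\cup\{\pm\infty\}$. Let $\mathcal{F}_1(p)$ be the collection of all test functions $f:\mathbb{Z}\to\mathbb{R}$ such that $x\mapsto f(x)p(x)$ is bounded on $S_p$ and $f(a)=0$. For $f:\mathbb{Z}\to\mathbb{R}$ define $$\mathcal{T}_1(f,p):\mathbb{Z}\to\mathbb{R}:\ x\mapsto \mathcal{T}_1(f,p)(x):=\frac{\Delta_x^+\big(f(x)p(x)\big)}{p(x)}\,\mathbb{I}_{S_p}(x).$$ Let $Z\sim p$ and let $X$ be a real-valued discrete random variable. (1) If $X\stackrel{\mathcal{L}}{=}Z$, then $\mathrm{E}[\mathcal{T}_1(f,p)(X)]=0$ for all $f\in\mathcal{F}_1(p)$. (2) If $\mathrm{E}[\mathcal{T}_1(f,p)(X)]=0$ for all $f\in\mathcal{F}_1(p)$, then $X\,|\,X\in S_p\stackrel{\mathcal{L}}{=}Z$, i.e. the conditional law of $X$ given $X\in S_p$ is the law of $Z$.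
   Context: A "density" means a discrete probability mass function $p:\mathbb{Z}\to[0,1]$; its support $S_p$ is the set where it is positive. $\mathbb{I}_A$ is the indicator function of $A$. $\Delta_x^+h(x):=h(x+1)-h(x)$ is the forward difference operator. Convention on division by zero: whenever an expression involves division by an indicator function $\mathbb{I}_A$ (for instance through division by $p(x)$, which carries the factor $\mathbb{I}_{S_p}(x)$), the expression is multiplied by that indicator instead; thus a quotient by $p(x)$ is $0$ when $x\notin S_p$. Equality in law is denoted $\stackrel{\mathcal{L}}{=}$.
   Formalization: If b=+∞, test functions must also satisfy f(x)p(x)→0 at +∞ ((1) fails otherwise); for a=-∞, f(a)=0 is read as f(x)p(x)→0 at -∞; E[T_1(f,p)(X)]=0 is only asserted where the expectation exists; (2) assumes P(X∈S_p)>0. *)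

theory Defs
  imports "HOL-Probability.Probability" "HOL-Library.Extended"
begin

text \<open>
  A density is an element of \<^typ>\<open>int pmf\<close>, with \<^term>\<open>set_pmf p\<close> its support \<open>S\<^sub>p\<close>.
  Endpoints in \<open>\<int> \<union> {\<plusminus>\<infinity>}\<close> are elements of \<^typ>\<open>int extended\<close>.
\<close>

definition int_segment :: "int extended \<Rightarrow> int extended \<Rightarrow> int set" where
  "int_segment a b = {x. a \<le> Fin x \<and> Fin x \<le> b}"

definition forward_diff :: "(int \<Rightarrow> real) \<Rightarrow> int \<Rightarrow> real" where
  "forward_diff h x = h (x + 1) - h x"

definition stein_op :: "(int \<Rightarrow> real) \<Rightarrow> int pmf \<Rightarrow> int \<Rightarrow> real" where
  "stein_op f p x =
     forward_diff (\<lambda>y. f y * pmf p y) x / pmf p x * indicator (set_pmf p) x"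

text \<open>
  The test functions. At an infinite left endpoint, \<open>f(a) = 0\<close> is read as
  \<open>f(x) p(x) \<rightarrow> 0\<close> for \<open>x \<rightarrow> -\<infinity>\<close>. At a finite right endpoint the boundary term
  \<open>f(b+1) p(b+1)\<close> of the telescoping sum of \<open>\<Delta>\<^sup>+(f p)\<close> over \<open>S\<^sub>p\<close> vanishes because
  \<open>p(b+1) = 0\<close>; at an infinite right endpoint this has to be demanded, as
  \<open>f(x) p(x) \<rightarrow> 0\<close> for \<open>x \<rightarrow> \<infinity>\<close>. Boundedness of \<open>f p\<close> alone does not suffice there:
  if \<open>S\<^sub>p = {0, 1, \<dots>}\<close>, \<open>f(0) = 0\<close> and \<open>f(x) = 1 / p(x)\<close> for \<open>x > 0\<close>, then
  \<open>stein_op f p\<close> has mean \<open>1\<close> under \<open>p\<close>.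
\<close>

definition stein_class :: "int extended \<Rightarrow> int extended \<Rightarrow> int pmf \<Rightarrow> (int \<Rightarrow> real) set" where
  "stein_class a b p = {f.
     bounded ((\<lambda>x. f x * pmf p x) ` set_pmf p) \<and>
     (case a of
        Fin m \<Rightarrow> f m = 0
      | Minf \<Rightarrow> ((\<lambda>x. f x * pmf p x) \<longlongrightarrow> 0) at_bot
      | Pinf \<Rightarrow> True) \<and>
     (b = Pinf \<longrightarrow> ((\<lambda>x. f x * pmf p x) \<longlongrightarrow> 0) at_top)}"

text \<open>
  A real-valued variable may leave \<open>\<int>\<close>; functions on \<open>\<int>\<close> that carry the
  indicator of a subset of \<open>\<int>\<close> are evaluated as \<open>0\<close> there.
\<close>

definition zero_extend :: "(int \<Rightarrow> real) \<Rightarrow> real \<Rightarrow> real" where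
  "zero_extend g y = (if y \<in> \<int> then g \<lfloor>y\<rfloor> else 0)"

definition law :: "'a measure \<Rightarrow> ('a \<Rightarrow> real) \<Rightarrow> real measure" where
  "law M X = distr M borel X"

text \<open>The conditional law of \<open>X\<close> given \<open>X \<in> A\<close>; meaningful if the event has positive probability.\<close>

definition cond_law :: "'a measure \<Rightarrow> ('a \<Rightarrow> real) \<Rightarrow> real set \<Rightarrow> real measure" where
  "cond_law M X A = law (uniform_measure M {\<omega> \<in> space M. X \<omega> \<in> A}) X"

end

theory Submission
  imports Defs
begin

text \<open>
  Write \<open>h = f p\<close> and \<open>q(x) = P(X = x)\<close>. For a test function \<open>f\<close> the difference \<open>\<Delta>\<^sup>+h\<close>
  vanishes off \<open>S\<^sub>p\<close>: beyond a right endpoint \<open>p\<close> is zero, and just before a finite left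
  endpoint \<open>a\<close> the condition \<open>f(a) = 0\<close> removes the jump of \<open>h\<close>. Hence the indicator and the
  division by \<open>p\<close> in the Stein operator cancel against the weight \<open>p\<close>
  (\<open>stein_op_times_pmf\<close>), and the mean of \<open>\<T>\<^sub>1(f,p)\<close> under \<open>p\<close> is the limit of the telescoping
  sums \<open>h(n) - h(-n)\<close>, which is \<open>0\<close> because \<open>h\<close> vanishes at both ends
  (\<open>stein_op_mean_zero\<close>). This is the first part.

  For the converse, test with the indicator \<open>f\<close> of a point \<open>x\<close> such that \<open>x - 1\<close> and \<open>x\<close>
  both lie in \<open>S\<^sub>p\<close>. Then \<open>h\<close> is a multiple of that indicator, and \<open>E[\<T>\<^sub>1(f,p)(X)] = 0\<close> says
  \<open>q(x - 1) / p(x - 1) = q(x) / p(x)\<close> (\<open>spike_mean\<close>). Since \<open>S\<^sub>p\<close> has no gaps, \<open>q / p\<close> is a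
  constant on \<open>S\<^sub>p\<close> (\<open>constant_on_gap_free\<close>), so the restriction of the law of \<open>X\<close> to \<open>S\<^sub>p\<close> is
  proportional to \<open>p\<close> and becomes \<open>p\<close> after normalisation (\<open>cond_law_of_proportional\<close>).
\<close>

section \<open>Forward differences and gap-free sets\<close>

lemma sum_forward_diff:
  assumes "a \<le> b"
  shows "(\<Sum>x\<in>{a..<b}. forward_diff h x) = h b - h a"
  using assms
proof (induction b rule: int_ge_induct)
  case base
  then show ?case by simp
next
  case (step i)
  have "{a..<i + 1} = insert i {a..<i}" using step.hyps by auto
  then show ?case using step by (simp add: forward_diff_def)
qed

lemma sum_forward_diff_tendsto_0:
  assumes "(h \<longlongrightarrow> 0) at_bot" and "(h \<longlongrightarrow> 0) at_top"
  shows "(\<lambda>n. \<Sum>x\<in>{- int n..<int n}. forward_diff h x) \<longlonglongrightarrow> 0"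
proof -
  have top: "filterlim int at_top sequentially"
    by (rule filterlim_int_sequentially)
  have bot: "filterlim (\<lambda>n. - int n) at_bot sequentially"
    unfolding filterlim_at_bot
  proof
    fix k
    show "\<forall>\<^sub>F n in sequentially. - int n \<le> k"
      by (rule eventually_mono[OF eventually_ge_at_top[of "nat (- k)"]]) linarith
  qed
  have "(\<lambda>n. h (int n) - h (- int n)) \<longlonglongrightarrow> 0 - 0"
    by (intro tendsto_diff filterlim_compose[OF assms(2) top] filterlim_compose[OF assms(1) bot])
  then show ?thesis by (simp add: sum_forward_diff)
qed

lemma int_segment_gap_free:
  assumes "x \<in> int_segment a b" "y \<in> int_segment a b" "x \<le> z" "z \<le> y"
  shows "z \<in> int_segment a b"
  using assms unfolding int_segment_def by (cases a; cases b) auto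

lemma constant_on_gap_free:
  fixes r :: "int \<Rightarrow> 'c"
  assumes gap_free: "\<And>x y z. x \<in> S \<Longrightarrow> y \<in> S \<Longrightarrow> x \<le> z \<Longrightarrow> z \<le> y \<Longrightarrow> z \<in> S"
    and step: "\<And>x. x - 1 \<in> S \<Longrightarrow> x \<in> S \<Longrightarrow> r (x - 1) = r x"
    and "x \<in> S" "y \<in> S"
  shows "r x = r y"
proof -
  have up: "y \<in> S \<longrightarrow> r x = r y" if "x \<le> y" "x \<in> S" for x y
    using that
  proof (induction y rule: int_ge_induct)
    case base
    then show ?case by simp
  next
    case (step i)
    show ?case
    proof
      assume "i + 1 \<in> S"
      then have "i \<in> S" using gap_free[of x "i + 1" i] step by simp
      then show "r x = r (i + 1)"
        using step assms(2)[of "i + 1"] \<open>i + 1 \<in> S\<close> by simp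
    qed
  qed
  show ?thesis
    using up[of x y] up[of y x] assms(3,4) linear[of x y] by metis
qed

section \<open>The Stein operator has mean zero\<close>

text \<open>
  The boundary conditions of the test class are what makes \<open>\<Delta>\<^sup>+(f p)\<close> vanish outside the
  support, so that no indicator is left on the right.
\<close>
lemma stein_op_times_pmf:
  assumes S: "set_pmf p = int_segment a b" and f: "f \<in> stein_class a b p"
  shows "stein_op f p x * pmf p x = forward_diff (\<lambda>y. f y * pmf p y) x"
proof (cases "x \<in> set_pmf p")
  case True
  then show ?thesis by (simp add: stein_op_def set_pmf_iff)
next
  case False
  have "f (x + 1) = 0" if "x + 1 \<in> set_pmf p"
  proof -
    have "a = Fin (x + 1)"
      using that False unfolding S int_segment_def by (cases a; cases b) auto
    then show ?thesis using f by (simp add: stein_class_def)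
  qed
  then have "f (x + 1) * pmf p (x + 1) = 0" by (auto simp: set_pmf_iff)
  then show ?thesis using False by (simp add: forward_diff_def set_pmf_iff)
qed

text \<open>
  At a finite endpoint the limit holds because \<open>f p\<close> is eventually zero there.
\<close>
lemma stein_class_tendsto_0:
  assumes S: "set_pmf p = int_segment a b" and f: "f \<in> stein_class a b p"
  shows "((\<lambda>y. f y * pmf p y) \<longlongrightarrow> 0) at_bot" and "((\<lambda>y. f y * pmf p y) \<longlongrightarrow> 0) at_top"
proof -
  have ev: "((\<lambda>y. f y * pmf p y) \<longlongrightarrow> 0) F" if "\<forall>\<^sub>F y in F. y \<notin> set_pmf p" for F
    by (rule tendsto_eventually, rule eventually_mono[OF that]) (simp add: set_pmf_iff)
  show "((\<lambda>y. f y * pmf p y) \<longlongrightarrow> 0) at_bot"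
  proof (cases a)
    case (Fin m)
    show ?thesis
      by (rule ev, rule eventually_mono[OF eventually_le_at_bot[of "m - 1"]])
        (auto simp: S int_segment_def Fin)
  next
    case Pinf
    show ?thesis by (rule ev) (simp add: S int_segment_def Pinf)
  next
    case Minf
    then show ?thesis using f by (simp add: stein_class_def)
  qed
  show "((\<lambda>y. f y * pmf p y) \<longlongrightarrow> 0) at_top"
  proof (cases b)
    case (Fin m)
    show ?thesis
      by (rule ev, rule eventually_mono[OF eventually_gt_at_top[of m]])
        (auto simp: S int_segment_def Fin)
  next
    case Pinf
    then show ?thesis using f by (simp add: stein_class_def)
  next
    case Minf
    show ?thesis by (rule ev) (simp add: S int_segment_def Minf)
  qed
qed

text \<open>
  If \<open>\<T>\<^sub>1(f,p)\<close> is integrable, dominated convergence computes its mean along the symmetric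
  windows \<open>{-n..<n}\<close>, over which the sum telescopes. Otherwise the Bochner integral is \<open>0\<close> by
  convention.
\<close>
lemma stein_op_mean_zero:
  assumes S: "set_pmf p = int_segment a b" and f: "f \<in> stein_class a b p"
  shows "(\<integral>x. stein_op f p x \<partial>measure_pmf p) = 0"
proof (cases "integrable (measure_pmf p) (stein_op f p)")
  case True
  define s where "s n x = stein_op f p x * indicator {- int n..<int n} x" for n x
  have pointwise: "(\<lambda>n. s n x) \<longlonglongrightarrow> stein_op f p x" for x
  proof (rule tendsto_eventually, rule eventually_mono[OF eventually_gt_at_top[of "nat \<bar>x\<bar>"]])
    fix n assume "nat \<bar>x\<bar> < n"
    then have "x \<in> {- int n..<int n}" by auto
    then show "s n x = stein_op f p x" by (simp add: s_def)
  qed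
  have "(\<lambda>n. \<integral>x. s n x \<partial>measure_pmf p) \<longlonglongrightarrow> (\<integral>x. stein_op f p x \<partial>measure_pmf p)"
    by (rule integral_dominated_convergence[where w = "\<lambda>x. norm (stein_op f p x)"])
      (use True pointwise in \<open>auto simp: s_def indicator_def\<close>)
  moreover have "(\<integral>x. s n x \<partial>measure_pmf p) =
      (\<Sum>x\<in>{- int n..<int n}. forward_diff (\<lambda>y. f y * pmf p y) x)" for n
  proof -
    have "(\<integral>x. s n x \<partial>measure_pmf p) = (\<Sum>x\<in>{- int n..<int n}. s n x * pmf p x)"
      by (rule integral_measure_pmf_real) (auto simp: s_def indicator_def split: if_splits)
    also have "\<dots> = (\<Sum>x\<in>{- int n..<int n}. forward_diff (\<lambda>y. f y * pmf p y) x)"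
      by (rule sum.cong) (simp_all add: s_def stein_op_times_pmf[OF S f])
    finally show ?thesis .
  qed
  ultimately show ?thesis
    using sum_forward_diff_tendsto_0[OF stein_class_tendsto_0[OF S f]] LIMSEQ_unique by simp
next
  case False
  then show ?thesis by (rule not_integrable_integral_eq)
qed

lemma zero_extend_measurable [measurable]: "zero_extend g \<in> borel_measurable borel"
proof -
  have "(\<lambda>y::real. g \<lfloor>y\<rfloor>) \<in> borel_measurable borel"
    by (rule measurable_compose[OF measurable_real_floor]) simp
  moreover have "{y::real. y \<in> \<int>} \<in> sets borel"
    by (simp add: countable_int closed_Ints borel_closed)
  ultimately show ?thesis
    unfolding zero_extend_def by (intro measurable_If_set) auto
qed

section \<open>Recovering the density from spikes\<close>

text \<open>
  With \<open>x - 1\<close> in the support, \<open>x\<close> is not the left endpoint, so a spike at \<open>x\<close> respects the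
  boundary condition there.
\<close>
lemma indicator_in_stein_class:
  assumes S: "set_pmf p = int_segment a b" and x: "x - 1 \<in> set_pmf p"
  shows "indicator {x} \<in> stein_class a b p"
proof -
  have "finite ((\<lambda>y. indicator {x} y * pmf p y) ` set_pmf p)"
    by (rule finite_subset[of _ "{0, pmf p x}"]) (auto simp: indicator_def)
  then have "bounded ((\<lambda>y. indicator {x} y * pmf p y) ` set_pmf p)"
    by (rule finite_imp_bounded)
  moreover have "((\<lambda>y. indicator {x} y * pmf p y) \<longlongrightarrow> 0) at_bot"
    by (rule tendsto_eventually, rule eventually_mono[OF eventually_le_at_bot[of "x - 1"]]) simp
  moreover have "((\<lambda>y. indicator {x} y * pmf p y) \<longlongrightarrow> 0) at_top"
    by (rule tendsto_eventually, rule eventually_mono[OF eventually_gt_at_top[of x]]) simp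
  moreover have "indicator {x} m = (0::real)" if "a = Fin m" for m
    using x that unfolding S int_segment_def by (auto simp: indicator_def)
  ultimately show ?thesis
    by (auto simp: stein_class_def split: extended.split)
qed

lemma stein_op_indicator:
  assumes "x - 1 \<in> set_pmf p" "x \<in> set_pmf p"
  shows "zero_extend (stein_op (indicator {x}) p) y =
    pmf p x * (indicator {real_of_int (x - 1)} y / pmf p (x - 1) - indicator {real_of_int x} y / pmf p x)"
proof (cases "y \<in> \<int>")
  case True
  then obtain z where "y = real_of_int z" by (auto elim: Ints_cases)
  moreover have "real_of_int z = real_of_int x - 1 \<longleftrightarrow> z = x - 1" by linarith
  ultimately show ?thesis
    using assms
    by (auto simp: zero_extend_def stein_op_def forward_diff_def indicator_def set_pmf_iff)
next
  case False
  then have "y \<noteq> real_of_int (x - 1)" "y \<noteq> real_of_int x" by auto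
  then show ?thesis using False by (simp add: zero_extend_def)
qed

text \<open>
  The spike at \<open>x\<close> compares the ratio of the two densities at the neighbours \<open>x - 1\<close> and \<open>x\<close>.
\<close>
lemma spike_mean:
  assumes "prob_space M" and [measurable]: "X \<in> borel_measurable M"
    and "x - 1 \<in> set_pmf p" "x \<in> set_pmf p"
  shows "(\<integral>\<omega>. zero_extend (stein_op (indicator {x}) p) (X \<omega>) \<partial>M) =
    pmf p x * (measure (law M X) {real_of_int (x - 1)} / pmf p (x - 1)
      - measure (law M X) {real_of_int x} / pmf p x)"
proof -
  interpret prob_space M by fact
  interpret L: prob_space "distr M borel X" by (rule prob_space_distr) measurable
  have "(\<integral>\<omega>. zero_extend (stein_op (indicator {x}) p) (X \<omega>) \<partial>M) =
    (\<integral>y. zero_extend (stein_op (indicator {x}) p) y \<partial>law M X)"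
    unfolding law_def by (subst integral_distr) auto
  also have "\<dots> = pmf p x * (measure (law M X) {real_of_int (x - 1)} / pmf p (x - 1)
      - measure (law M X) {real_of_int x} / pmf p x)"
    unfolding stein_op_indicator[OF assms(3,4)] law_def
    by (subst integral_mult_right_zero, subst Bochner_Integration.integral_diff)
      (auto simp: L.emeasure_eq_measure)
  finally show ?thesis .
qed

text \<open>
  The constant \<open>c\<close> is forced to be \<open>P(X \<in> S\<^sub>p)\<close>, because \<open>p\<close> has total mass \<open>1\<close>; so
  conditioning divides exactly by \<open>c\<close>.
\<close>
lemma cond_law_of_proportional:
  fixes p :: "int pmf"
  assumes "prob_space M" and [measurable]: "X \<in> borel_measurable M"
    and ratio: "\<And>x. x \<in> set_pmf p \<Longrightarrow> measure (law M X) {real_of_int x} = c * pmf p x"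
    and "c \<ge> 0"
    and pos: "measure M {\<omega> \<in> space M. X \<omega> \<in> real_of_int ` set_pmf p} > 0"
  shows "cond_law M X (real_of_int ` set_pmf p) = law (measure_pmf p) real_of_int"
proof -
  interpret prob_space M by fact
  let ?S = "real_of_int ` set_pmf p"
  let ?E = "{\<omega> \<in> space M. X \<omega> \<in> ?S}"
  have [measurable]: "?S \<in> sets borel"
    by (rule sets.countable) (auto intro: countable_image)
  have mass: "emeasure M {\<omega> \<in> space M. X \<omega> \<in> real_of_int ` B} = ennreal c * emeasure (measure_pmf p) B"
    if "B \<subseteq> set_pmf p" for B
  proof -
    interpret L: prob_space "distr M borel X" by (rule prob_space_distr) measurable
    have B: "countable B" using that countable_set_pmf countable_subset by blast
    have "emeasure M {\<omega> \<in> space M. X \<omega> \<in> real_of_int ` B} = emeasure (law M X) (\<Union>x\<in>B. {real_of_int x})"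
      unfolding law_def using B
      by (subst emeasure_distr) (auto intro!: arg_cong[where f = "emeasure M"] sets.countable_UN'')
    also have "\<dots> = (\<integral>\<^sup>+x. emeasure (law M X) {real_of_int x} \<partial>count_space B)"
      using B by (intro emeasure_UN_countable) (auto simp: law_def disjoint_family_on_def)
    also have "\<dots> = (\<integral>\<^sup>+x. ennreal c * ennreal (pmf p x) \<partial>count_space B)"
      using that ratio \<open>c \<ge> 0\<close>
      by (intro nn_integral_cong) (auto simp: law_def L.emeasure_eq_measure ennreal_mult)
    also have "\<dots> = ennreal c * emeasure (measure_pmf p) B"
      by (simp add: nn_integral_cmult nn_integral_pmf)
    finally show ?thesis .
  qed
  have total: "emeasure M ?E = ennreal c"
    using mass[of "set_pmf p"] measure_pmf.emeasure_eq_1_AE[of "set_pmf p" p]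
    by (simp add: AE_measure_pmf)
  then have "c > 0" using pos \<open>c \<ge> 0\<close> by (simp add: emeasure_eq_measure)
  show ?thesis
  proof (rule measure_eqI)
    fix A assume "A \<in> sets (cond_law M X ?S)"
    then have [measurable]: "A \<in> sets borel" by (simp add: cond_law_def law_def)
    let ?B = "{x \<in> set_pmf p. real_of_int x \<in> A}"
    have "emeasure (cond_law M X ?S) A =
        emeasure M (?E \<inter> (X -` A \<inter> space M)) / emeasure M ?E"
      unfolding cond_law_def law_def by (subst emeasure_distr) auto
    also have "?E \<inter> (X -` A \<inter> space M) = {\<omega> \<in> space M. X \<omega> \<in> real_of_int ` ?B}" by auto
    also have "emeasure M \<dots> / emeasure M ?E = emeasure (measure_pmf p) ?B"
      using \<open>c > 0\<close> mass[of ?B]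
        ennreal_mult_divide_eq[of "ennreal c" "emeasure (measure_pmf p) ?B"]
      by (simp add: total mult.commute[of "ennreal c"])
    also have "\<dots> = emeasure (law (measure_pmf p) real_of_int) A"
      unfolding law_def
      by (subst emeasure_distr) (auto intro!: emeasure_eq_AE simp: AE_measure_pmf_iff)
    finally show "emeasure (cond_law M X ?S) A = emeasure (law (measure_pmf p) real_of_int) A" .
  qed (simp add: cond_law_def law_def)
qed

section \<open>The characterisation\<close>

theorem theorem2p1:
  fixes p :: "int pmf" and a b :: "int extended"
    and N :: "'b measure" and Z :: "'b \<Rightarrow> int"
    and M :: "'a measure" and X :: "'a \<Rightarrow> real"
  assumes "a < b"
    and "set_pmf p = int_segment a b"
    and "prob_space N"
    and "Z \<in> measurable N (count_space UNIV)"
    and "distr N (count_space UNIV) Z = measure_pmf p"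
    and "prob_space M"
    and "X \<in> borel_measurable M"
    and "\<exists>C. countable C \<and> (AE \<omega> in M. X \<omega> \<in> C)"
  shows "(law M X = law N (\<lambda>\<omega>. real_of_int (Z \<omega>)) \<longrightarrow>
            (\<forall>f \<in> stein_class a b p. (\<integral>\<omega>. zero_extend (stein_op f p) (X \<omega>) \<partial>M) = 0))
       \<and> ((\<forall>f \<in> stein_class a b p. (\<integral>\<omega>. zero_extend (stein_op f p) (X \<omega>) \<partial>M) = 0) \<longrightarrow>
            measure M {\<omega> \<in> space M. X \<omega> \<in> real_of_int ` set_pmf p} > 0 \<longrightarrow>
            cond_law M X (real_of_int ` set_pmf p) = law N (\<lambda>\<omega>. real_of_int (Z \<omega>)))"
proof -
  interpret M: prob_space M by fact
  have [measurable]: "X \<in> borel_measurable M" "Z \<in> measurable N (count_space UNIV)"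
    by fact+
  note S = assms(2)
  have law_Z: "law N (\<lambda>\<omega>. real_of_int (Z \<omega>)) = law (measure_pmf p) real_of_int"
    unfolding law_def assms(5)[symmetric] by (subst distr_distr) (auto simp: comp_def)
  have direct: "(\<integral>\<omega>. zero_extend (stein_op f p) (X \<omega>) \<partial>M) = 0"
    if "law M X = law (measure_pmf p) real_of_int" "f \<in> stein_class a b p" for f
  proof -
    have "(\<integral>\<omega>. zero_extend (stein_op f p) (X \<omega>) \<partial>M) =
        (\<integral>y. zero_extend (stein_op f p) y \<partial>law M X)"
      unfolding law_def by (subst integral_distr) auto
    also have "\<dots> = (\<integral>x. zero_extend (stein_op f p) (real_of_int x) \<partial>measure_pmf p)"
      unfolding that(1) unfolding law_def by (subst integral_distr) auto
    also have "\<dots> = 0"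
      using stein_op_mean_zero[OF S that(2)] by (simp add: zero_extend_def)
    finally show ?thesis .
  qed
  have converse: "cond_law M X (real_of_int ` set_pmf p) = law (measure_pmf p) real_of_int"
    if zero: "\<forall>f \<in> stein_class a b p. (\<integral>\<omega>. zero_extend (stein_op f p) (X \<omega>) \<partial>M) = 0"
      and pos: "measure M {\<omega> \<in> space M. X \<omega> \<in> real_of_int ` set_pmf p} > 0"
  proof -
    define r where "r x = measure (law M X) {real_of_int x} / pmf p x" for x
    have step: "r (x - 1) = r x" if "x - 1 \<in> set_pmf p" "x \<in> set_pmf p" for x
    proof -
      have "pmf p x * (r (x - 1) - r x) = 0"
        using spike_mean[OF assms(6,7) that] zero indicator_in_stein_class[OF S that(1)]
        by (simp add: r_def)
      then show ?thesis using that(2) by (simp add: set_pmf_iff)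
    qed
    obtain x0 where x0: "x0 \<in> set_pmf p" using set_pmf_not_empty[of p] by blast
    have const: "r x = r x0" if "x \<in> set_pmf p" for x
      by (rule constant_on_gap_free[where r = r, OF _ step that x0])
        (unfold S, rule int_segment_gap_free)
    show ?thesis
    proof (rule cond_law_of_proportional[OF assms(6,7) _ _ pos])
      show "measure (law M X) {real_of_int x} = r x0 * pmf p x" if "x \<in> set_pmf p" for x
        using const[OF that] that by (simp add: r_def set_pmf_iff field_simps)
      show "r x0 \<ge> 0" by (simp add: r_def)
    qed
  qed
  show ?thesis
    unfolding law_Z using direct converse by blast
qed

end
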